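(* (i) For every integer $K\ge3$ and every $\lambda_0\in\{-4,4\}$, there are potentials $V:\mathbb Z^2\to\mathbb C$ supported on exactly $K$ sites (i.e. $V(n)\neq0$ for exactly $K$ points $n$) such that $\lambda_0$ is an eigenvalue of $\Delta+V$ on $\ell^2(\mathbb Z^2)$. (ii) If $V:\mathbb Z^2\to\mathbb C$ is supported on at most two sites, then neither $4$ nor $-4$ is an eigenvalue of $\Delta+V$ on $\ell^2(\mathbb Z^2)$.
   Context: $\Delta$ is the (uncentered) nearest-neighbor adjacency operator on $\mathbb Z^2$, $(\Delta u)(n)=\sum_{j=1}^2\bigl(u(n+e_j)+u(n-e_j)\bigr)$, with $e_1,e_2$ the standard basis vectors, and $V$ acts by multiplication: $(Vu)(n)=V(n)u(n)$. A number $\lambda_0$ is an eigenvalue of $\Delta+V$ if there is a nonzero $u\in\ell^2(\mathbb Z^2)$ with $(\Delta+V)u=\lambda_0u$. *)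

theory Defs
  imports "HOL-Analysis.Analysis"
begin

type_synonym site = "int \<times> int"

definition unit_vecs :: "site set" where
  "unit_vecs = {(1, 0), (0, 1)}"

definition adjacency :: "(site \<Rightarrow> complex) \<Rightarrow> site \<Rightarrow> complex" where
  "adjacency u n = (\<Sum>e\<in>unit_vecs. u (n + e) + u (n - e))"

definition mult_op :: "(site \<Rightarrow> complex) \<Rightarrow> (site \<Rightarrow> complex) \<Rightarrow> site \<Rightarrow> complex" where
  "mult_op V u n = V n * u n"

definition schroedinger :: "(site \<Rightarrow> complex) \<Rightarrow> (site \<Rightarrow> complex) \<Rightarrow> site \<Rightarrow> complex" where
  "schroedinger V u n = adjacency u n + mult_op V u n"

definition ell2 :: "(site \<Rightarrow> complex) set" where
  "ell2 = {u. (\<lambda>n. (norm (u n))\<^sup>2) summable_on UNIV}"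

definition is_eigenvalue ::
  "((site \<Rightarrow> complex) \<Rightarrow> site \<Rightarrow> complex) \<Rightarrow> complex \<Rightarrow> bool" where
  "is_eigenvalue H \<mu> \<longleftrightarrow>
     (\<exists>u\<in>ell2. u \<noteq> (\<lambda>n. 0) \<and> (\<forall>n. H u n = \<mu> * u n))"

definition supp :: "(site \<Rightarrow> complex) \<Rightarrow> site set" where
  "supp V = {n. V n \<noteq> 0}"

end

theory Submission
  imports Defs "HOL-Real_Asymp.Real_Asymp"
begin

text \<open>
  Conjugation by the checkerboard sign \<open>(-1)^(x+y)\<close> exchanges the energies \<open>4\<close> and \<open>-4\<close>, so only
  \<open>(4 - \<Delta>) u = V u\<close> matters. If \<open>u\<close> is square summable and \<open>f = (4 - \<Delta>) u\<close> has finite support,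
  then \<open>f\<close> is orthogonal to every affine function \<open>h\<close>: pairing \<open>u\<close> with \<open>(4 - \<Delta>) (h \<chi>)\<close>, where \<open>\<chi>\<close> is a
  cutoff at scale \<open>R\<close>, leaves an error \<open>O(1/R)\<close> times the sum of \<open>|u|\<close> over a square of side \<open>O(R)\<close>,
  which tends to zero. An \<open>f\<close> supported on at most two sites therefore vanishes, and then \<open>u = 0\<close> by the
  maximum principle.

  Conversely, \<open>(4 - \<Delta>) g = 2\<delta>(0) - \<delta>(e) - \<delta>(-e)\<close> with \<open>e = (1, 0)\<close> has a square summable solution
  \<open>g\<close>, obtained by a Fourier integral in the first coordinate. It is nonzero at \<open>0\<close> and at \<open>\<plusminus>e\<close>, so for all
  but finitely many \<open>t\<close> the combination \<open>u = \<Sum>j\<le>L. t^j g(\<cdot> - j e)\<close> and its source are both nonzero exactly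
  where they have to be on the \<open>L + 3\<close> sites \<open>-e, \<dots>, (L + 1) e\<close>, and \<open>V\<close> is the quotient of the two.
\<close>

subsection \<open>Affine moments of square summable solutions\<close>

lemma adjacency_pair:
  "adjacency u (x, y) = u (x + 1, y) + u (x - 1, y) + u (x, y + 1) + u (x, y - 1)"
  by (simp add: adjacency_def unit_vecs_def)

section \<open>Averages of square summable functions over squares\<close>

definition square :: "nat \<Rightarrow> site set" where
  "square R = {- int R..int R} \<times> {- int R..int R}"

lemma finite_square [simp]: "finite (square R)"
  by (simp add: square_def)

lemma card_square: "card (square R) = (2 * R + 1)\<^sup>2"
  by (simp add: square_def power2_eq_square card_cartesian_product nat_add_distrib nat_mult_distrib)

lemma finite_subset_square:
  assumes "finite F"
  obtains R where "F \<subseteq> square R"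
proof
  show "F \<subseteq> square (\<Sum>n\<in>F. nat \<bar>fst n\<bar> + nat \<bar>snd n\<bar>)"
  proof
    fix n assume "n \<in> F"
    then have "nat \<bar>fst n\<bar> + nat \<bar>snd n\<bar> \<le> (\<Sum>n\<in>F. nat \<bar>fst n\<bar> + nat \<bar>snd n\<bar>)"
      using assms by (intro member_le_sum) auto
    then show "n \<in> square (\<Sum>n\<in>F. nat \<bar>fst n\<bar> + nat \<bar>snd n\<bar>)"
      by (cases n) (auto simp: square_def simp del: of_nat_sum)
  qed
qed

lemma sum_le_sqrt_card:
  fixes f :: "'a \<Rightarrow> real"
  shows "(\<Sum>n\<in>A. f n) \<le> sqrt (card A) * sqrt (\<Sum>n\<in>A. (f n)\<^sup>2)"
proof -
  have "(\<Sum>n\<in>A. 1 * f n)\<^sup>2 \<le> (\<Sum>n\<in>A. 1\<^sup>2) * (\<Sum>n\<in>A. (f n)\<^sup>2)"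
    by (rule Cauchy_Schwarz_ineq_sum)
  then have "(\<Sum>n\<in>A. f n)\<^sup>2 \<le> card A * (\<Sum>n\<in>A. (f n)\<^sup>2)" by simp
  then have "sqrt ((\<Sum>n\<in>A. f n)\<^sup>2) \<le> sqrt (card A * (\<Sum>n\<in>A. (f n)\<^sup>2))"
    using real_sqrt_le_mono by blast
  then show ?thesis by (simp add: real_sqrt_mult)
qed

lemma ell2_finite_tail:
  assumes "u \<in> ell2" "e > 0"
  obtains F where "finite F" "\<And>A. finite A \<Longrightarrow> A \<inter> F = {} \<Longrightarrow> (\<Sum>n\<in>A. (norm (u n))\<^sup>2) < e"
proof -
  let ?f = "\<lambda>n. (norm (u n))\<^sup>2"
  have s: "?f summable_on UNIV" using assms(1) by (simp add: ell2_def)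
  have "(?f has_sum infsum ?f UNIV) UNIV" using s by simp
  then have "\<forall>\<^sub>F F in finite_subsets_at_top UNIV. dist (sum ?f F) (infsum ?f UNIV) < e"
    using assms(2) unfolding has_sum_def by (rule tendstoD)
  then obtain F where F: "finite F" "dist (sum ?f F) (infsum ?f UNIV) < e"
    by (auto simp: eventually_finite_subsets_at_top)
  have "sum ?f A < e" if "finite A" "A \<inter> F = {}" for A
  proof -
    have "sum ?f (A \<union> F) \<le> infsum ?f UNIV"
      using F that s by (intro finite_sum_le_infsum) auto
    then show ?thesis using F that by (simp add: sum.union_disjoint dist_real_def)
  qed
  then show thesis using that F by blast
qed

text \<open>Cauchy-Schwarz on a square of about 4 R^2 sites only bounds this average. Applied off a
  finite set that carries almost all of the square sum, it gives something small, and the finite set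
  itself contributes O(1/R).\<close>

lemma ell2_square_average_tendsto_0:
  assumes "u \<in> ell2"
  shows "(\<lambda>R. (\<Sum>n\<in>square (Suc R). norm (u n)) / R) \<longlonglongrightarrow> 0"
proof (rule LIMSEQ_I)
  fix r :: real assume r: "r > 0"
  \<comment> \<open>A tail of norm at most r / 10 contributes at most (2 R + 3) r / 10 \<le> R r / 2
    for R \<ge> 1; the choice of \<open>N\<close> keeps \<open>C\<close> below the other
    half.\<close>
  obtain F where F: "finite F" "\<And>A. finite A \<Longrightarrow> A \<inter> F = {} \<Longrightarrow> (\<Sum>n\<in>A. (norm (u n))\<^sup>2) < (r / 10)\<^sup>2"
    using ell2_finite_tail[OF assms, of "(r / 10)\<^sup>2"] r by auto
  define C where "C = (\<Sum>n\<in>F. norm (u n))"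
  obtain N :: nat where N: "N > 2 * C / r" using reals_Archimedean2 by blast
  show "\<exists>no. \<forall>R\<ge>no. norm ((\<Sum>n\<in>square (Suc R). norm (u n)) / R - 0) < r"
  proof (intro exI allI impI)
    fix R assume R: "Suc N \<le> R"
    let ?B = "square (Suc R) - F"
    have "(\<Sum>n\<in>square (Suc R). norm (u n)) = (\<Sum>n\<in>square (Suc R) \<inter> F. norm (u n)) + (\<Sum>n\<in>?B. norm (u n))"
      by (subst sum.union_disjoint[symmetric]) (auto intro!: sum.cong)
    also have "(\<Sum>n\<in>square (Suc R) \<inter> F. norm (u n)) \<le> C"
      unfolding C_def using F by (intro sum_mono2) auto
    also have "(\<Sum>n\<in>?B. norm (u n)) \<le> sqrt (card ?B) * sqrt (\<Sum>n\<in>?B. (norm (u n))\<^sup>2)"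
      by (rule sum_le_sqrt_card)
    also have "\<dots> \<le> (2 * R + 3) * (r / 10)"
    proof (intro mult_mono)
      have "card ?B \<le> card (square (Suc R))" by (intro card_mono) auto
      also have "\<dots> = (2 * R + 3)\<^sup>2" by (simp add: card_square numeral_eq_Suc)
      finally have "real (card ?B) \<le> (real (2 * R + 3))\<^sup>2"
        by (metis of_nat_le_iff of_nat_power)
      then show "sqrt (card ?B) \<le> real (2 * R + 3)"
        by (intro real_le_lsqrt) auto
      have "(\<Sum>n\<in>?B. (norm (u n))\<^sup>2) \<le> (r / 10)\<^sup>2" using F(2)[of ?B] by (simp add: Diff_Int_distrib2 less_imp_le Int_commute)
      then show "sqrt (\<Sum>n\<in>?B. (norm (u n))\<^sup>2) \<le> r / 10"
        using r by (intro real_le_lsqrt) auto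
    qed (auto intro: sum_nonneg)
    also have "\<dots> \<le> (5 * R) * (r / 10)"
      using r R by (intro mult_right_mono) auto
    finally have "(\<Sum>n\<in>square (Suc R). norm (u n)) \<le> C + R * r / 2" by (simp add: mult.commute)
    moreover have "C < R * r / 2"
    proof -
      have "C < N * r / 2" using N r by (simp add: field_simps)
      also have "\<dots> \<le> R * r / 2" using R r by simp
      finally show ?thesis .
    qed
    ultimately have "(\<Sum>n\<in>square (Suc R). norm (u n)) < R * r" by linarith
    moreover have "R > 0" using R by simp
    moreover have "(\<Sum>n\<in>square (Suc R). norm (u n)) \<ge> 0" by (intro sum_nonneg) auto
    ultimately show "norm ((\<Sum>n\<in>square (Suc R). norm (u n)) / R - 0) < r"
      by (simp add: field_simps)
  qed
qed

text \<open>
  The square makes the cutoff \<open>C\<^sup>1\<close> across the circle of radius \<open>R\<close>; a kink there would spoil the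
  error bound.
\<close>
definition cutoff :: "nat \<Rightarrow> site \<Rightarrow> real" where
  "cutoff R n = (max 0 ((real R)\<^sup>2 - (real_of_int (fst n))\<^sup>2 - (real_of_int (snd n))\<^sup>2))\<^sup>2"

definition affine_fun :: "real \<Rightarrow> real \<Rightarrow> real \<Rightarrow> site \<Rightarrow> real" where
  "affine_fun \<alpha> \<beta> \<gamma> n = \<alpha> + \<beta> * real_of_int (fst n) + \<gamma> * real_of_int (snd n)"

section \<open>Error bound for the cut-off affine functions\<close>

lemma cutoff_nonzero:
  assumes "cutoff R n \<noteq> 0"
  shows "n \<in> square R"
proof -
  have p: "(real_of_int (fst n))\<^sup>2 + (real_of_int (snd n))\<^sup>2 < (real R)\<^sup>2"
    using assms by (auto simp: cutoff_def max_def split: if_splits)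
  have "\<bar>real_of_int (fst n)\<bar>\<^sup>2 < (real R)\<^sup>2" "\<bar>real_of_int (snd n)\<bar>\<^sup>2 < (real R)\<^sup>2"
    unfolding power2_abs
    using p zero_le_power2[of "real_of_int (fst n)"] zero_le_power2[of "real_of_int (snd n)"]
    by linarith+
  then have "\<bar>real_of_int (fst n)\<bar> < real R" "\<bar>real_of_int (snd n)\<bar> < real R"
    by (auto intro: power2_less_imp_less simp del: power2_abs)
  then show ?thesis by (cases n) (auto simp: square_def)
qed

text \<open>First-order Taylor estimate for the square of the positive part: its derivative 2 max 0
  t is Lipschitz with constant 2, so the bound survives a sign change between s and t.\<close>

lemma pos_part_square_taylor:
  fixes s t :: real
  shows "\<bar>(max 0 t)\<^sup>2 - (max 0 s)\<^sup>2 - 2 * max 0 s * (t - s)\<bar> \<le> (t - s)\<^sup>2"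
proof -
  consider "s \<le> 0" "t \<le> 0" | "s \<le> 0" "t > 0" | "s > 0" "t \<le> 0" | "s > 0" "t > 0" by linarith
  then show ?thesis
  proof cases
    case 2
    then have "t\<^sup>2 \<le> (t - s)\<^sup>2" by (intro power_mono) auto
    then show ?thesis using 2 by simp
  next
    case 3
    have "0 \<le> s * (s - 2 * t)" "s * (s - 2 * t) \<le> (t - s)\<^sup>2"
      using 3 by (simp, simp add: power2_eq_square algebra_simps)
    moreover have "(max 0 t)\<^sup>2 - (max 0 s)\<^sup>2 - 2 * max 0 s * (t - s) = s * (s - 2 * t)"
      using 3 by (simp add: power2_eq_square algebra_simps)
    ultimately show ?thesis by simp
  next
    case 4
    then have "(max 0 t)\<^sup>2 - (max 0 s)\<^sup>2 - 2 * max 0 s * (t - s) = (t - s)\<^sup>2"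
      by (simp add: power2_eq_square algebra_simps)
    then show ?thesis by simp
  qed simp
qed


text \<open>Summation by parts: a unit shift of the support of w stays inside
  \<open>square (Suc R)\<close>, so no boundary terms appear.\<close>

lemma adjacency_swap:
  assumes w: "\<And>n. w n \<noteq> 0 \<Longrightarrow> n \<in> square R"
  shows "(\<Sum>n\<in>square (Suc R). adjacency u n * w n) = (\<Sum>n\<in>square (Suc R). u n * adjacency w n)"
proof -
  have shift: "(\<Sum>n\<in>square (Suc R). u (n + e) * w n) = (\<Sum>n\<in>square (Suc R). u n * w (n - e))"
    if e: "e \<in> {(1, 0), (-1, 0), (0, 1), (0, -1)}" for e
  proof (rule sum.reindex_bij_witness_not_neutral[where i = "\<lambda>n. n - e" and j = "\<lambda>n. n + e"
        and S' = "{n \<in> square (Suc R). w n = 0}" and T' = "{n \<in> square (Suc R). w (n - e) = 0}"])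
    fix n assume n: "n \<in> square (Suc R) - {n \<in> square (Suc R). w n = 0}"
    then have "n \<in> square R" using w by auto
    then show "n + e \<in> square (Suc R) - {n \<in> square (Suc R). w (n - e) = 0}"
      using n e by (cases n) (auto simp: square_def)
  next
    fix n assume n: "n \<in> square (Suc R) - {n \<in> square (Suc R). w (n - e) = 0}"
    then have "n - e \<in> square R" using w by auto
    then show "n - e \<in> square (Suc R) - {n \<in> square (Suc R). w n = 0}"
      using n e by (cases n) (auto simp: square_def)
  qed (auto intro: finite_subset[OF _ finite_square])
  have 1: "adjacency u n * w n = u (n + (1, 0)) * w n + u (n + (-1, 0)) * w n
      + u (n + (0, 1)) * w n + u (n + (0, -1)) * w n" for n
    by (cases n) (simp add: adjacency_pair algebra_simps)
  have 2: "u n * adjacency w n = u n * w (n - (1, 0)) + u n * w (n - (-1, 0))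
      + u n * w (n - (0, 1)) + u n * w (n - (0, -1))" for n
    by (cases n) (simp add: adjacency_pair algebra_simps)
  show ?thesis unfolding 1 2 sum.distrib by (simp add: shift)
qed

text \<open>The cutoff has size R^4 and each difference gains a factor 1/R. As affine functions are
  harmonic, what remains is h = O(R) times second differences and the slopes times first differences
  of the cutoff, all O(R^3).\<close>

lemma cutoff_affine_bound:
  fixes \<alpha> \<beta> \<gamma> :: real
  assumes R: "R \<ge> 1" and n: "n \<in> square (Suc R)"
  defines "w \<equiv> \<lambda>n. complex_of_real (affine_fun \<alpha> \<beta> \<gamma> n * cutoff R n)"
  shows "norm (4 * w n - adjacency w n) \<le> 400 * (\<bar>\<alpha>\<bar> + \<bar>\<beta>\<bar> + \<bar>\<gamma>\<bar>) * real R ^ 3"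
proof -
  define r where "r = real R"
  obtain x y where xy: "n = (x, y)" by (cases n)
  define a where "a = real_of_int x"
  define b where "b = real_of_int y"
  define s where "s = r\<^sup>2 - a\<^sup>2 - b\<^sup>2"
  define q where "q = (\<lambda>t::real. (max 0 t)\<^sup>2)"
  define p where "p = max 0 s"
  define h where "h = \<alpha> + \<beta> * a + \<gamma> * b"
  define H where "H = \<bar>\<alpha>\<bar> + \<bar>\<beta>\<bar> + \<bar>\<gamma>\<bar>"
  have r1: "r \<ge> 1" using R by (simp add: r_def)
  have "real_of_int \<bar>x\<bar> \<le> real_of_int (int R + 1)" "real_of_int \<bar>y\<bar> \<le> real_of_int (int R + 1)"
    using n unfolding of_int_le_iff by (auto simp: xy square_def)
  then have ab: "\<bar>a\<bar> \<le> 2 * r" "\<bar>b\<bar> \<le> 2 * r"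
    using r1 by (auto simp: a_def b_def r_def)
  have h: "\<bar>h\<bar> \<le> 2 * H * r"
  proof -
    have "\<bar>\<alpha>\<bar> \<le> \<bar>\<alpha>\<bar> * (2 * r)" using r1 by (simp add: mult_le_cancel_left1)
    moreover have "\<bar>\<beta> * a\<bar> \<le> \<bar>\<beta>\<bar> * (2 * r)" "\<bar>\<gamma> * b\<bar> \<le> \<bar>\<gamma>\<bar> * (2 * r)"
      using ab unfolding abs_mult by (auto intro!: mult_left_mono)
    moreover have "2 * H * r = \<bar>\<alpha>\<bar> * (2 * r) + \<bar>\<beta>\<bar> * (2 * r) + \<bar>\<gamma>\<bar> * (2 * r)"
      by (simp add: H_def algebra_simps)
    ultimately show ?thesis unfolding h_def by linarith
  qed
  have p: "0 \<le> p" "p \<le> r\<^sup>2" by (auto simp: p_def s_def)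
  \<comment> \<open>Taylor remainder of \<open>q\<close> at \<open>s\<close>. A step to a neighbour
    changes \<open>s\<close> by one of -2a-1, 2a-1, -2b-1, 2b-1.\<close>
  define T where "T = (\<lambda>d. q (s + d) - q s - 2 * p * d)"
  have T: "\<bar>T d\<bar> \<le> 25 * r\<^sup>2" if "\<bar>d\<bar> \<le> 5 * r" for d
  proof -
    have "\<bar>T d\<bar> \<le> d\<^sup>2"
      using pos_part_square_taylor[of "s + d" s] by (simp add: T_def q_def p_def)
    also have "\<dots> \<le> (5 * r)\<^sup>2" using that r1 by (intro abs_le_square_iff[THEN iffD1]) auto
    finally show ?thesis by (simp add: power_mult_distrib)
  qed
  have d: "\<bar>-2 * a - 1\<bar> \<le> 5 * r" "\<bar>2 * a - 1\<bar> \<le> 5 * r" "\<bar>-2 * b - 1\<bar> \<le> 5 * r" "\<bar>2 * b - 1\<bar> \<le> 5 * r"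
    using ab r1 by linarith+
  \<comment> \<open>The four increments add up to -4, whence the term 8 p; opposite ones differ by 4
    a or 4 b, whence the slope terms.\<close>
  define W where "W = h * (8 * p - T (-2 * a - 1) - T (2 * a - 1) - T (-2 * b - 1) - T (2 * b - 1))
      - \<beta> * (- 8 * p * a + T (-2 * a - 1) - T (2 * a - 1))
      - \<gamma> * (- 8 * p * b + T (-2 * b - 1) - T (2 * b - 1))"
  have s4: "r\<^sup>2 - (a + 1)\<^sup>2 - b\<^sup>2 = s + (-2 * a - 1)" "r\<^sup>2 - (a - 1)\<^sup>2 - b\<^sup>2 = s + (2 * a - 1)"
       "r\<^sup>2 - a\<^sup>2 - (b + 1)\<^sup>2 = s + (-2 * b - 1)" "r\<^sup>2 - a\<^sup>2 - (b - 1)\<^sup>2 = s + (2 * b - 1)"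
    by (simp_all add: s_def power2_eq_square algebra_simps)
  have w: "w (x, y) = of_real (h * q s)"
    "w (x + 1, y) = of_real ((h + \<beta>) * q (s + (-2 * a - 1)))"
    "w (x - 1, y) = of_real ((h - \<beta>) * q (s + (2 * a - 1)))"
    "w (x, y + 1) = of_real ((h + \<gamma>) * q (s + (-2 * b - 1)))"
    "w (x, y - 1) = of_real ((h - \<gamma>) * q (s + (2 * b - 1)))"
    unfolding s4[symmetric] by (simp_all add: w_def affine_fun_def cutoff_def q_def s_def h_def a_def b_def r_def
        algebra_simps)
  have q: "q (s + d) = T d + q s + 2 * p * d" for d by (simp add: T_def)
  have "4 * w n - adjacency w n = of_real (4 * (h * q s) - ((h + \<beta>) * q (s + (-2 * a - 1))
     + (h - \<beta>) * q (s + (2 * a - 1)) + (h + \<gamma>) * q (s + (-2 * b - 1)) + (h - \<gamma>) * q (s + (2 * b - 1))))"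
    unfolding xy adjacency_pair w by simp
  also have "\<dots> = of_real W" unfolding q W_def by (simp add: algebra_simps)
  finally have "norm (4 * w n - adjacency w n) = \<bar>W\<bar>" by simp
  \<comment> \<open>108 = 8 + 4 * 25 and 66 = 16 + 2 * 25, from p \<le> r^2, |p a| \<le> 2 r^3, |p
    b| \<le> 2 r^3 and |T| \<le> 25 r^2.\<close>
  also have "\<dots> \<le> (2 * H * r) * (108 * r\<^sup>2) + \<bar>\<beta>\<bar> * (66 * r ^ 3) + \<bar>\<gamma>\<bar> * (66 * r ^ 3)"
  proof -
    have r23: "r\<^sup>2 \<le> r ^ 3" using r1 by (intro power_increasing) auto
    have pa: "\<bar>p * a\<bar> \<le> 2 * r ^ 3" "\<bar>p * b\<bar> \<le> 2 * r ^ 3"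
    proof -
      have "p * \<bar>a\<bar> \<le> r\<^sup>2 * (2 * r)" "p * \<bar>b\<bar> \<le> r\<^sup>2 * (2 * r)" using p ab by (auto intro!: mult_mono)
      then show "\<bar>p * a\<bar> \<le> 2 * r ^ 3" "\<bar>p * b\<bar> \<le> 2 * r ^ 3"
        using p by (auto simp: abs_mult power2_eq_square power3_eq_cube mult_ac)
    qed
    note T4 = T[OF d(1)] T[OF d(2)] T[OF d(3)] T[OF d(4)]
    have X: "\<bar>8 * p - T (-2 * a - 1) - T (2 * a - 1) - T (-2 * b - 1) - T (2 * b - 1)\<bar> \<le> 108 * r\<^sup>2"
      using T4 p by linarith
    have Y: "\<bar>- 8 * p * a + T (-2 * a - 1) - T (2 * a - 1)\<bar> \<le> 66 * r ^ 3"
      "\<bar>- 8 * p * b + T (-2 * b - 1) - T (2 * b - 1)\<bar> \<le> 66 * r ^ 3"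
      using T4 pa r23 by linarith+
    have "\<bar>h * (8 * p - T (-2 * a - 1) - T (2 * a - 1) - T (-2 * b - 1) - T (2 * b - 1))\<bar>
         \<le> (2 * H * r) * (108 * r\<^sup>2)"
      unfolding abs_mult[of h] using h X by (intro mult_mono) auto
    moreover have
      "\<bar>\<beta> * (- 8 * p * a + T (-2 * a - 1) - T (2 * a - 1))\<bar> \<le> \<bar>\<beta>\<bar> * (66 * r ^ 3)"
      "\<bar>\<gamma> * (- 8 * p * b + T (-2 * b - 1) - T (2 * b - 1))\<bar> \<le> \<bar>\<gamma>\<bar> * (66 * r ^ 3)"
      unfolding abs_mult[of \<beta>] abs_mult[of \<gamma>] by (intro mult_left_mono Y abs_ge_zero)+
    ultimately show ?thesis unfolding W_def by linarith
  qed
  also have "\<dots> \<le> 400 * H * r ^ 3"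
  proof -
    have "0 \<le> \<bar>\<alpha>\<bar> * r ^ 3" "0 \<le> \<bar>\<beta>\<bar> * r ^ 3" "0 \<le> \<bar>\<gamma>\<bar> * r ^ 3" using r1 by auto
    then show ?thesis unfolding H_def by (simp add: power2_eq_square power3_eq_cube algebra_simps)
  qed
  finally show ?thesis by (simp add: H_def r_def)
qed

text \<open>Divided by R^4, the cutoff tends to 1 at each site, so \<open>M\<close> tends to the
  moment. Summation by parts and the R^3 bound dominate \<open>M\<close> by a constant times the
  vanishing square average.\<close>

lemma affine_moment_zero:
  assumes u: "u \<in> ell2" and S: "finite S" and f: "\<And>n. n \<notin> S \<Longrightarrow> 4 * u n - adjacency u n = 0"
  shows "(\<Sum>n\<in>S. (4 * u n - adjacency u n) * of_real (affine_fun \<alpha> \<beta> \<gamma> n)) = 0"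
proof -
  let ?f = "\<lambda>n. 4 * u n - adjacency u n"
  let ?h = "affine_fun \<alpha> \<beta> \<gamma>"
  define H where "H = 400 * (\<bar>\<alpha>\<bar> + \<bar>\<beta>\<bar> + \<bar>\<gamma>\<bar>)"
  define M where "M = (\<lambda>R. \<Sum>n\<in>S. ?f n * of_real (?h n) * of_real (cutoff R n / real R ^ 4))"
  obtain R0 where R0: "S \<subseteq> square R0" using finite_subset_square[OF S] .
  have bound: "norm (M R) \<le> H * ((\<Sum>n\<in>square (Suc R). norm (u n)) / R)" if R: "R \<ge> Suc R0" for R
  proof -
    define w where "w = (\<lambda>n. complex_of_real (?h n * cutoff R n))"
    have sub: "S \<subseteq> square (Suc R)" using R0 R by (auto simp: square_def)
    have wR: "n \<in> square R" if "w n \<noteq> 0" for n using that cutoff_nonzero by (auto simp: w_def)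
    have "of_real (real R ^ 4) * M R = (\<Sum>n\<in>S. ?f n * w n)"
      using R by (simp add: M_def w_def sum_distrib_left mult_ac)
    also have "\<dots> = (\<Sum>n\<in>square (Suc R). ?f n * w n)"
      using sub f by (intro sum.mono_neutral_left) auto
    also have "\<dots> = (\<Sum>n\<in>square (Suc R). 4 * u n * w n) - (\<Sum>n\<in>square (Suc R). adjacency u n * w n)"
      by (simp add: algebra_simps sum_subtractf)
    also have "\<dots> = (\<Sum>n\<in>square (Suc R). u n * (4 * w n - adjacency w n))"
      by (subst adjacency_swap[OF wR]) (simp_all add: algebra_simps sum_subtractf)
    finally have "norm (of_real (real R ^ 4) * M R) \<le> (\<Sum>n\<in>square (Suc R). norm (u n) * (H * real R ^ 3))"
      using cutoff_affine_bound[of R _ \<alpha> \<beta> \<gamma>] R unfolding w_def H_def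
      by (auto intro!: sum_norm_le mult_left_mono simp: norm_mult)
    then have "real R ^ 4 * norm (M R) \<le> real R ^ 3 * H * (\<Sum>n\<in>square (Suc R). norm (u n))"
      by (simp add: norm_mult norm_power sum_distrib_left mult_ac)
    then show ?thesis using R by (simp add: field_simps power3_eq_cube power4_eq_xxxx)
  qed
  have "(\<lambda>R. H * ((\<Sum>n\<in>square (Suc R). norm (u n)) / R)) \<longlonglongrightarrow> H * 0"
    by (intro tendsto_intros ell2_square_average_tendsto_0 u)
  then have "(\<lambda>R. H * ((\<Sum>n\<in>square (Suc R). norm (u n)) / R)) \<longlonglongrightarrow> 0" by simp
  then have M0: "M \<longlonglongrightarrow> 0"
    by (rule Lim_null_comparison[rotated]) (use bound in \<open>auto simp: eventually_sequentially\<close>)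
  have cut: "(\<lambda>R. cutoff R n / real R ^ 4) \<longlonglongrightarrow> 1" for n
    unfolding cutoff_def by real_asymp
  have "M \<longlonglongrightarrow> (\<Sum>n\<in>S. ?f n * of_real (?h n) * of_real 1)"
    unfolding M_def by (intro tendsto_intros cut)
  then have "M \<longlonglongrightarrow> (\<Sum>n\<in>S. ?f n * of_real (?h n))" by simp
  then show ?thesis using M0 LIMSEQ_unique by blast
qed

section \<open>Absence of the eigenvalue 4 for at most two sites\<close>

text \<open>Square summability makes |u| attain its maximum, and only at finitely many sites. At a
  rightmost one the right neighbour is strictly smaller, against the mean value property.\<close>

lemma ell2_harmonic_zero:
  assumes u: "u \<in> ell2" and eq: "\<And>n. adjacency u n = 4 * u n"
  shows "u = (\<lambda>n. 0)"
proof (rule ccontr)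
  assume "u \<noteq> (\<lambda>n. 0)"
  then obtain n0 where n0: "u n0 \<noteq> 0" by blast
  obtain F where F: "finite F" "\<And>A. finite A \<Longrightarrow> A \<inter> F = {} \<Longrightarrow> (\<Sum>n\<in>A. (norm (u n))\<^sup>2) < (norm (u n0))\<^sup>2"
    using ell2_finite_tail[OF u, of "(norm (u n0))\<^sup>2"] n0 by auto
  have out: "norm (u n) < norm (u n0)" if "n \<notin> F" for n
  proof -
    have "(norm (u n))\<^sup>2 < (norm (u n0))\<^sup>2" using F(2)[of "{n}"] that by simp
    then show ?thesis by (rule power2_less_imp_less) simp
  qed
  have n0F: "n0 \<in> F" using out by blast
  define M where "M = Max ((\<lambda>n. norm (u n)) ` F)"
  have le: "norm (u n) \<le> M" for n
  proof (cases "n \<in> F")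
    case False
    then have "norm (u n) \<le> norm (u n0)" using out by (simp add: less_imp_le)
    also have "\<dots> \<le> M" unfolding M_def using F n0F by auto
    finally show ?thesis .
  qed (use F in \<open>auto simp: M_def\<close>)
  define X where "X = {n \<in> F. norm (u n) = M}"
  have inX: "n \<in> X" if "norm (u n) = M" for n
    using that out[of n] le[of n0] by (auto simp: X_def)
  have "M \<in> (\<lambda>n. norm (u n)) ` F" unfolding M_def using F n0F by (intro Max_in) auto
  then have X: "finite X" "X \<noteq> {}" using F by (auto simp: X_def)
  obtain x y where xy: "(x, y) \<in> X" "\<And>n. n \<in> X \<Longrightarrow> fst n \<le> x"
  proof -
    have "Max (fst ` X) \<in> fst ` X" using X by (intro Max_in) auto
    then obtain n where "n \<in> X" "Max (fst ` X) = fst n" by auto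
    then show thesis using X that[of "fst n" "snd n"] by (metis Max_ge finite_imageI imageI prod.collapse)
  qed
  have "norm (u (x + 1, y)) \<noteq> M" using inX xy(2)[of "(x + 1, y)"] by auto
  then have lt: "norm (u (x + 1, y)) < M" using le[of "(x + 1, y)"] by simp
  have "4 * M = norm (4 * u (x, y))" using xy(1) by (simp add: X_def norm_mult)
  also have "\<dots> = norm (u (x + 1, y) + u (x - 1, y) + u (x, y + 1) + u (x, y - 1))"
    using eq[of "(x, y)"] by (simp add: adjacency_pair)
  also have "\<dots> \<le> norm (u (x + 1, y)) + norm (u (x - 1, y)) + norm (u (x, y + 1)) + norm (u (x, y - 1))"
    by (intro norm_triangle_mono order_refl)
  also have "\<dots> < 4 * M" using lt le[of "(x - 1, y)"] le[of "(x, y + 1)"] le[of "(x, y - 1)"] by linarith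
  finally show False by simp
qed

lemma not_eigenvalue_4:
  assumes "finite (supp V)" "card (supp V) \<le> 2"
  shows "\<not> is_eigenvalue (schroedinger V) 4"
proof
  assume "is_eigenvalue (schroedinger V) 4"
  then obtain u where u: "u \<in> ell2" "u \<noteq> (\<lambda>n. 0)" and "\<forall>n. schroedinger V u n = 4 * u n"
    by (auto simp: is_eigenvalue_def)
  then have eq: "4 * u n - adjacency u n = V n * u n" for n
    unfolding schroedinger_def mult_op_def by (metis add_diff_cancel_left')
  have "V a * u a = 0" for a
  proof (cases "a \<in> supp V")
    case a: True
    have c: "card (supp V - {a}) \<le> 1" using assms a by simp
    obtain b where b: "supp V \<subseteq> {a, b}" "a \<noteq> b"
    proof (cases "supp V - {a} = {}")
      case True
      \<comment> \<open>For a one-site support any second point serves.\<close>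
      then show thesis using that[of "a + (1, 0)"] by (cases a) auto
    next
      case False
      then have "card (supp V - {a}) \<noteq> 0" using assms by simp
      then have "card (supp V - {a}) = 1" using c by simp
      then obtain c where "supp V - {a} = {c}" by (auto simp: card_1_singleton_iff)
      then show thesis using that[of c] by auto
    qed
    obtain a1 a2 b1 b2 where ab: "a = (a1, a2)" "b = (b1, b2)" by (cases a, cases b)
    \<comment> \<open>The inner product of n - b with a - b: zero at b and positive at a, so its
      moment isolates the source at a.\<close>
    let ?h = "affine_fun (- real_of_int (b1 * (a1 - b1) + b2 * (a2 - b2)))
        (real_of_int (a1 - b1)) (real_of_int (a2 - b2))"
    have ha: "?h a = (real_of_int (a1 - b1))\<^sup>2 + (real_of_int (a2 - b2))\<^sup>2" and hb: "?h b = 0"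
      by (simp_all add: affine_fun_def ab power2_eq_square algebra_simps)
    have "?h a \<noteq> 0" unfolding ha using b(2) by (auto simp: ab sum_power2_eq_zero_iff)
    moreover have "(\<Sum>n\<in>{a, b}. (4 * u n - adjacency u n) * of_real (?h n)) = 0"
      using b(1) unfolding supp_def by (intro affine_moment_zero u) (auto simp: eq)
    ultimately show ?thesis using b(2) hb by (simp add: eq)
  qed (simp add: supp_def)
  then have "adjacency u n = 4 * u n" for n using eq[of n] by (metis eq_iff_diff_eq_0)
  then show False using ell2_harmonic_zero u by blast
qed

subsection \<open>Existence for three or more sites\<close>

lemma eigenvalue_sign_flip:
  assumes "is_eigenvalue (schroedinger V) \<mu>"
  shows "is_eigenvalue (schroedinger (\<lambda>n. - V n)) (- \<mu>)"
proof -
  obtain u where u: "u \<in> ell2" "u \<noteq> (\<lambda>n. 0)" and eq: "\<And>n. schroedinger V u n = \<mu> * u n"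
    using assms by (auto simp: is_eigenvalue_def)
  define \<epsilon> :: "site \<Rightarrow> complex" where "\<epsilon> = (\<lambda>n. if even (fst n + snd n) then 1 else -1)"
  let ?u = "\<lambda>n. \<epsilon> n * u n"
  have "norm (\<epsilon> n) = 1" for n by (simp add: \<epsilon>_def)
  then have "?u \<in> ell2" using u(1) by (simp add: ell2_def norm_mult)
  moreover have "?u \<noteq> (\<lambda>n. 0)" using u(2) by (auto simp: \<epsilon>_def fun_eq_iff split: if_splits)
  moreover have "schroedinger (\<lambda>n. - V n) ?u n = - \<mu> * ?u n" for n
  proof (cases n)
    case (Pair x y)
    \<comment> \<open>Neighbours have opposite parity, so \<open>adjacency\<close> anticommutes with
      the sign, whereas multiplication by V commutes with it.\<close>
    have "schroedinger (\<lambda>n. - V n) ?u n = - \<epsilon> n * schroedinger V u n"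
      by (simp add: Pair schroedinger_def mult_op_def adjacency_pair \<epsilon>_def algebra_simps)
    then show ?thesis by (simp add: eq)
  qed
  ultimately show ?thesis unfolding is_eigenvalue_def by blast
qed

lemma supp_uminus: "supp (\<lambda>n. - V n) = supp V"
  by (simp add: supp_def)

text \<open>
  \<open>decay x\<close> is the root \<open>r \<le> 1\<close> of \<open>r + 1/r = 4 - 2 cos x\<close>, and \<open>profile x\<close> equals
  \<open>(2 - 2 cos x) / (4 - 2 cos x - 2 decay x)\<close> with the singularity at \<open>x = 0\<close> removed. The integral for
  \<open>green\<close> lacks the factor \<open>1 / (2\<pi>)\<close>.
\<close>
definition rootA :: "real \<Rightarrow> real" where "rootA x = sqrt (1 - cos x)"
definition rootB :: "real \<Rightarrow> real" where "rootB x = sqrt (3 - cos x)"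
definition profile :: "real \<Rightarrow> real" where "profile x = rootA x / rootB x"
definition decay :: "real \<Rightarrow> real" where "decay x = (rootB x - rootA x)\<^sup>2 / 2"

definition green :: "site \<Rightarrow> real" where
  "green n = integral {-pi..pi} (\<lambda>x. profile x * decay x ^ nat \<bar>snd n\<bar> * cos (real_of_int (fst n) * x))"

section \<open>Algebra of the Fourier integrand\<close>

lemma cos_less_3: "cos x < (3::real)"
  using cos_le_one[of x] by linarith

lemma rootA_sq: "(rootA x)\<^sup>2 = 1 - cos x" and rootB_sq: "(rootB x)\<^sup>2 = 3 - cos x"
  using cos_less_3[of x] by (simp_all add: rootA_def rootB_def)

lemma rootA_nonneg: "0 \<le> rootA x" and rootB_pos: "0 < rootB x"
  and rootA_less_rootB: "rootA x < rootB x"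
  using cos_less_3[of x] by (auto simp: rootA_def rootB_def)

text \<open>With A = \<open>rootA x\<close> and B = \<open>rootB x\<close>, the numbers (B - A)^2 /
  2 and (B + A)^2 / 2 have product 1, since B^2 - A^2 = 2, and sum A^2 + B^2 = 4 - 2 cos x.\<close>

lemma decay_root: "(decay x)\<^sup>2 + 1 = (4 - 2 * cos x) * decay x"
proof -
  have "decay x * ((rootB x + rootA x)\<^sup>2 / 2) = (((rootB x)\<^sup>2 - (rootA x)\<^sup>2) / 2)\<^sup>2"
    by (simp add: decay_def power2_eq_square algebra_simps)
  also have "\<dots> = 1" by (simp add: rootA_sq rootB_sq)
  finally have 1: "decay x * ((rootB x + rootA x)\<^sup>2 / 2) = 1" .
  have 2: "decay x + (rootB x + rootA x)\<^sup>2 / 2 = 4 - 2 * cos x"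
    using rootA_sq[of x] rootB_sq[of x]
    by (simp add: decay_def power2_sum power2_diff field_simps)
  show ?thesis using 1 unfolding 2[symmetric] by (simp add: power2_eq_square algebra_simps)
qed

text \<open>On row 0 the operator acts on the integrand through 4 - 2 cos x - 2
  \<open>decay x\<close> = 2 A B; \<open>profile\<close> turns this into the symbol of the second
  difference.\<close>

lemma profile_source: "profile x * (4 - 2 * cos x - 2 * decay x) = 2 * (1 - cos x)"
proof -
  have "4 - 2 * cos x - 2 * decay x = (rootA x)\<^sup>2 + (rootB x)\<^sup>2 - (rootB x - rootA x)\<^sup>2"
    by (simp add: decay_def rootA_sq rootB_sq)
  also have "\<dots> = 2 * rootA x * rootB x" by (simp add: power2_eq_square algebra_simps)
  finally have "profile x * (4 - 2 * cos x - 2 * decay x) = 2 * (rootA x)\<^sup>2"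
    using rootB_pos[of x] by (simp add: profile_def power2_eq_square)
  then show ?thesis by (simp add: rootA_sq)
qed

lemma decay_nonneg: "0 \<le> decay x"
  by (simp add: decay_def)

text \<open>This makes the sum over rows converge uniformly in size: as x tends to 0,
  \<open>decay x\<close> tends to 1 and the geometric series blows up like 1 / (1 -
  \<open>decay x\<close>), which \<open>profile\<close> compensates. The key facts are 1 -
  \<open>decay x\<close> = A (B - A) and B (B - A) \<ge> 1.\<close>

lemma profile_sq_le: "(profile x)\<^sup>2 \<le> 1 - decay x"
proof -
  define a b where "a = rootA x" and "b = rootB x"
  have ab: "0 \<le> a" "a < b" "0 < b" "b\<^sup>2 = a\<^sup>2 + 2"
    using rootA_nonneg rootA_less_rootB rootB_pos by (auto simp: a_def b_def rootA_sq rootB_sq)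
  have d: "1 - decay x = a * (b - a)"
    using ab by (simp add: decay_def a_def[symmetric] b_def[symmetric] power2_diff field_simps power2_eq_square)
  have "(b - a) * (b + a) = 2" using ab(4) by (simp add: power2_eq_square algebra_simps)
  then have "2 \<le> (b - a) * (2 * b)" using ab by (smt (verit) mult_left_mono)
  then have "1 \<le> (b - a) * b" by simp
  then have "a * a * 1 \<le> a * b * ((b - a) * b)" using ab by (intro mult_mono) auto
  then have "a\<^sup>2 \<le> a * (b - a) * b\<^sup>2" by (simp add: power2_eq_square mult_ac)
  then show ?thesis
    using ab(3) unfolding d profile_def a_def[symmetric] b_def[symmetric] power_divide
    by (subst pos_divide_le_eq) auto
qed

lemma decay_le_1: "decay x \<le> 1"
  using profile_sq_le[of x] zero_le_power2[of "profile x"] by linarith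

lemma continuous_on_profile [continuous_intros]: "continuous_on S profile"
proof -
  have "sqrt (3 - cos x) \<noteq> 0" for x using cos_less_3[of x] by simp
  then show ?thesis unfolding profile_def rootA_def rootB_def
    by (intro continuous_intros) auto
qed

lemma continuous_on_decay [continuous_intros]: "continuous_on S decay"
  unfolding decay_def rootA_def rootB_def by (intro continuous_intros) auto

section \<open>Bessel's inequality for cosine coefficients\<close>

lemma has_integral_cos_mult_cos:
  "((\<lambda>x. cos (real_of_int k * x) * cos (real_of_int l * x)) has_integral
     pi * (of_bool (k = l) + of_bool (k = - l))) {-pi..pi}"
proof -
  have "((\<lambda>x. (cos (real_of_int (k - l) * x) + cos (real_of_int (k + l) * x)) / 2) has_integral
     ((if k - l = 0 then 2 * pi else 0) + (if k + l = 0 then 2 * pi else 0)) / 2) {-pi..pi}"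
    by (intro has_integral_divide has_integral_add has_integral_cos_nx)
  moreover have "((if k - l = 0 then 2 * pi else 0) + (if k + l = 0 then 2 * pi else 0)) / 2
      = pi * (of_bool (k = l) + of_bool (k = - l))" by (auto simp: eq_neg_iff_add_eq_0)
  moreover have "(cos (real_of_int (k - l) * x) + cos (real_of_int (k + l) * x)) / 2
      = cos (real_of_int k * x) * cos (real_of_int l * x)" for x
    by (simp add: cos_times_cos left_diff_distrib distrib_right)
  ultimately show ?thesis by simp
qed

text \<open>The integral of (2 pi g - S)^2 is nonnegative. Each cosine occurs for k and -k, so S^2
  integrates to 2 pi Q, while g S integrates to Q; the multiplier 2 pi yields the best
  constant.\<close>

lemma cosine_bessel:
  fixes g :: "real \<Rightarrow> real"
  assumes g: "continuous_on {-pi..pi} g"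
  shows "(\<Sum>k\<in>{- int N..int N}. (integral {-pi..pi} (\<lambda>x. g x * cos (real_of_int k * x)))\<^sup>2)
           \<le> 2 * pi * integral {-pi..pi} (\<lambda>x. (g x)\<^sup>2)"
proof -
  define c where "c = (\<lambda>k. integral {-pi..pi} (\<lambda>x. g x * cos (real_of_int k * x)))"
  define K where "K = {- int N..int N}"
  define S where "S = (\<lambda>x. \<Sum>k\<in>K. c k * cos (real_of_int k * x))"
  define Q where "Q = (\<Sum>k\<in>K. (c k)\<^sup>2)"
  define G where "G = integral {-pi..pi} (\<lambda>x. (g x)\<^sup>2)"
  have fin: "finite K" by (simp add: K_def)
  have cneg: "c (- k) = c k" for k by (simp add: c_def)
  have dbl: "((\<lambda>x. \<Sum>k\<in>K. \<Sum>l\<in>K. (c k * c l) * (cos (real_of_int k * x) * cos (real_of_int l * x))) has_integral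
      (\<Sum>k\<in>K. \<Sum>l\<in>K. (c k * c l) * (pi * (of_bool (k = l) + of_bool (k = - l))))) {-pi..pi}"
    by (intro has_integral_sum fin has_integral_mult_right has_integral_cos_mult_cos)
  \<comment> \<open>The terms l = k and l = -k contribute equally because \<open>c\<close> is even;
    at k = 0 they coincide and both indicators count.\<close>
  have norms: "(\<Sum>l\<in>K. (c k * c l) * (pi * (of_bool (k = l) + of_bool (k = - l)))) = 2 * pi * (c k)\<^sup>2"
    if k: "k \<in> K" for k
  proof -
    have delta: "(\<Sum>l\<in>K. c l * of_bool (i = l)) = c i" if "i \<in> K" for i
    proof -
      have "(\<Sum>l\<in>K. c l * of_bool (i = l)) = (\<Sum>l\<in>K. if i = l then c l else 0)"
        by (intro sum.cong) auto
      then show ?thesis using that fin by simp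
    qed
    note 1 = delta[OF k]
    have "(\<Sum>l\<in>K. c l * of_bool (k = - l)) = (\<Sum>l\<in>K. c l * of_bool (- k = l))"
      by (intro sum.cong) (auto simp: minus_equation_iff)
    also have "\<dots> = c (- k)" using k by (intro delta) (auto simp: K_def)
    also have "\<dots> = c k" by (rule cneg)
    finally have 2: "(\<Sum>l\<in>K. c l * of_bool (k = - l)) = c k" .
    have "(\<Sum>l\<in>K. (c k * c l) * (pi * (of_bool (k = l) + of_bool (k = - l))))
       = c k * pi * ((\<Sum>l\<in>K. c l * of_bool (k = l)) + (\<Sum>l\<in>K. c l * of_bool (k = - l)))"
      unfolding sum.distrib[symmetric] sum_distrib_left by (simp add: algebra_simps)
    then show ?thesis unfolding 1 2 by (simp add: power2_eq_square)
  qed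
  have Sx: "(\<Sum>k\<in>K. \<Sum>l\<in>K. (c k * c l) * (cos (real_of_int k * x) * cos (real_of_int l * x))) = (S x)\<^sup>2" for x
    by (simp add: S_def power2_eq_square sum_product mult_ac)
  have "(\<Sum>k\<in>K. \<Sum>l\<in>K. (c k * c l) * (pi * (of_bool (k = l) + of_bool (k = - l)))) = 2 * pi * Q"
    unfolding Q_def sum_distrib_left by (intro sum.cong refl norms)
  then have SS: "((\<lambda>x. (S x)\<^sup>2) has_integral 2 * pi * Q) {-pi..pi}"
    using dbl unfolding Sx by (simp only:)
  have cint: "((\<lambda>x. g x * cos (real_of_int k * x)) has_integral c k) {-pi..pi}" for k
    unfolding c_def by (intro integrable_integral integrable_continuous_real continuous_intros g)
  have gSsum: "((\<lambda>x. \<Sum>k\<in>K. c k * (g x * cos (real_of_int k * x))) has_integral (\<Sum>k\<in>K. c k * c k)) {-pi..pi}"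
    by (intro has_integral_sum fin has_integral_mult_right cint)
  have gSx: "(\<Sum>k\<in>K. c k * (g x * cos (real_of_int k * x))) = g x * S x" for x
    unfolding S_def sum_distrib_left by (intro sum.cong) (simp_all add: mult_ac)
  have gS: "((\<lambda>x. g x * S x) has_integral Q) {-pi..pi}"
    using gSsum unfolding gSx Q_def power2_eq_square .
  have gg: "((\<lambda>x. (g x)\<^sup>2) has_integral G) {-pi..pi}"
    unfolding G_def by (intro integrable_integral integrable_continuous_real continuous_intros g)
  have sq_int: "((\<lambda>x. (2 * pi)\<^sup>2 * (g x)\<^sup>2 - 4 * pi * (g x * S x) + (S x)\<^sup>2) has_integral
     (2 * pi)\<^sup>2 * G - 4 * pi * Q + 2 * pi * Q) {-pi..pi}"
    by (intro has_integral_add has_integral_diff has_integral_mult_right gg gS SS)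
  have sq: "(2 * pi)\<^sup>2 * (g x)\<^sup>2 - 4 * pi * (g x * S x) + (S x)\<^sup>2 = (2 * pi * g x - S x)\<^sup>2" for x
    by (simp add: power2_diff power2_eq_square algebra_simps)
  have "0 \<le> (2 * pi)\<^sup>2 * G - 4 * pi * Q + 2 * pi * Q"
    by (rule has_integral_nonneg[OF sq_int]) (simp only: sq zero_le_power2)
  then have "(2 * pi) * Q \<le> (2 * pi) * (2 * pi * G)" by (simp add: power2_eq_square algebra_simps)
  then have "Q \<le> 2 * pi * G" by (rule mult_left_le_imp_le) simp
  then show ?thesis by (simp add: Q_def G_def K_def c_def)
qed

section \<open>Lattice equation and square summability of \<open>green\<close>\<close>

lemma has_integral_green:
  "((\<lambda>x. profile x * decay x ^ nat \<bar>m\<bar> * cos (real_of_int k * x)) has_integral green (k, m)) {-pi..pi}"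
  unfolding green_def fst_conv snd_conv
  by (intro integrable_integral integrable_continuous_real continuous_intros)

text \<open>The factor 2 pi is the normalisation left out of \<open>green\<close>; the separate
  conditionals mirror the integrals of cosines over a period.\<close>

definition source :: "int \<Rightarrow> real" where
  "source k = 2 * (if k = 0 then 2 * pi else 0) - (if k = -1 then 2 * pi else 0) - (if k = 1 then 2 * pi else 0)"

text \<open>The operator is applied under the integral. On row 0 both vertical neighbours carry
  \<open>decay x\<close>, and \<open>profile_source\<close> leaves pure cosines; on every other row
  \<open>decay_root\<close> kills the integrand.\<close>

lemma green_source:
  "4 * green (k, m) - (green (k + 1, m) + green (k - 1, m) + green (k, m + 1) + green (k, m - 1))
     = (if m = 0 then source k else 0)"
proof -
  let ?I = "\<lambda>k m x. profile x * decay x ^ nat \<bar>m\<bar> * cos (real_of_int k * x)"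
  let ?J = "\<lambda>x. 4 * ?I k m x - (?I (k + 1) m x + ?I (k - 1) m x + ?I k (m + 1) x + ?I k (m - 1) x)"
  have int: "(?J has_integral 4 * green (k, m)
      - (green (k + 1, m) + green (k - 1, m) + green (k, m + 1) + green (k, m - 1))) {-pi..pi}"
    by (intro has_integral_diff has_integral_add has_integral_mult_right has_integral_green)
  have cc: "cos (real_of_int (k + 1) * x) + cos (real_of_int (k - 1) * x) = 2 * cos x * cos (real_of_int k * x)" for x
    by (simp add: distrib_right left_diff_distrib cos_add cos_diff)
  have J: "?J x = cos (real_of_int k * x) * (profile x *
      ((4 - 2 * cos x) * decay x ^ nat \<bar>m\<bar> - decay x ^ nat \<bar>m + 1\<bar> - decay x ^ nat \<bar>m - 1\<bar>))" for x
  proof -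
    have "?J x = profile x * decay x ^ nat \<bar>m\<bar> * (4 * cos (real_of_int k * x)
       - (cos (real_of_int (k + 1) * x) + cos (real_of_int (k - 1) * x)))
       - ?I k (m + 1) x - ?I k (m - 1) x" by (simp add: algebra_simps)
    then show ?thesis unfolding cc by (simp only: algebra_simps)
  qed
  show ?thesis
  proof (cases "m = 0")
    case True
    have J0: "?J x = 2 * cos (real_of_int k * x) - cos (real_of_int (k + 1) * x) - cos (real_of_int (k - 1) * x)" for x
    proof -
      have "?J x = cos (real_of_int k * x) * (profile x * (4 - 2 * cos x - 2 * decay x))"
        unfolding J using True by simp
      also have "\<dots> = 2 * cos (real_of_int k * x) - 2 * cos x * cos (real_of_int k * x)"
        unfolding profile_source by (simp add: algebra_simps)
      finally show ?thesis unfolding cc[symmetric] by simp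
    qed
    have "((\<lambda>x. 2 * cos (real_of_int k * x) - cos (real_of_int (k + 1) * x) - cos (real_of_int (k - 1) * x))
      has_integral 2 * (if k = 0 then 2 * pi else 0) - (if k + 1 = 0 then 2 * pi else 0) - (if k - 1 = 0 then 2 * pi else 0)) {-pi..pi}"
      by (intro has_integral_diff has_integral_mult_right has_integral_cos_nx)
    moreover have "2 * (if k = 0 then 2 * pi else 0) - (if k + 1 = 0 then 2 * pi else 0) - (if k - 1 = 0 then 2 * pi else 0) = source k"
      by (auto simp: source_def)
    ultimately have "(?J has_integral source k) {-pi..pi}" unfolding J0 by (simp only:)
    from has_integral_unique[OF int this] show ?thesis using True by (simp only: simp_thms if_True)
  next
    case False
    have J0: "?J x = 0" for x
    proof -
      obtain j where j: "nat \<bar>m\<bar> = Suc j" using False by (cases "nat \<bar>m\<bar>") auto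
      \<comment> \<open>One vertical neighbour is closer to row 0 and the other farther away; which
        is which depends on the sign of m.\<close>
      then have "nat \<bar>m + 1\<bar> = j + 2 \<and> nat \<bar>m - 1\<bar> = j \<or> nat \<bar>m + 1\<bar> = j \<and> nat \<bar>m - 1\<bar> = j + 2"
        by linarith
      then have "(4 - 2 * cos x) * decay x ^ nat \<bar>m\<bar> - decay x ^ nat \<bar>m + 1\<bar> - decay x ^ nat \<bar>m - 1\<bar>
        = decay x ^ j * ((4 - 2 * cos x) * decay x - ((decay x)\<^sup>2 + 1))"
      proof (elim disjE conjE)
        assume e: "nat \<bar>m + 1\<bar> = j + 2" "nat \<bar>m - 1\<bar> = j"
        show ?thesis unfolding j e by (simp add: power_add power2_eq_square ring_distribs mult_ac)
      next
        assume e: "nat \<bar>m + 1\<bar> = j" "nat \<bar>m - 1\<bar> = j + 2"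
        show ?thesis unfolding j e by (simp add: power_add power2_eq_square ring_distribs mult_ac)
      qed
      then show ?thesis unfolding J decay_root by (simp only: diff_self mult_zero_right)
    qed
    have "(?J has_integral 0) {-pi..pi}" unfolding J0 by (rule has_integral_0)
    from has_integral_unique[OF int this] show ?thesis using False by (simp only: if_False)
  qed
qed

text \<open>The closed form avoids dividing by 1 - r, so r = 1, the value of \<open>decay\<close> at
  0, is covered.\<close>

lemma sum_symmetric_geometric_le:
  fixes r :: real
  assumes "0 \<le> r" "r \<le> 1"
  shows "(\<Sum>m\<in>{- int N..int N}. (1 - r) * r ^ nat \<bar>m\<bar>) \<le> 2"
proof -
  have "(\<Sum>m\<in>{- int N..int N}. (1 - r) * r ^ nat \<bar>m\<bar>) = 1 + r - 2 * r ^ Suc N"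
  proof (induction N)
    case (Suc N)
    have "{- int (Suc N)..int (Suc N)} = insert (int (Suc N)) (insert (- int (Suc N)) {- int N..int N})" by auto
    then show ?case using Suc by (simp add: nat_add_distrib algebra_simps)
  qed simp
  moreover have "0 \<le> r ^ Suc N" using assms by simp
  ultimately show ?thesis using assms by linarith
qed

text \<open>Bessel in k on each row m, then summation over m under the integral, where the sum is at
  most 2. The constant is 2 pi times 2 times the length 2 pi.\<close>

lemma sum_green_sq_le: "(\<Sum>n\<in>square N. (green n)\<^sup>2) \<le> 8 * pi\<^sup>2"
proof -
  let ?K = "{- int N..int N}"
  let ?g = "\<lambda>m x. profile x * decay x ^ nat \<bar>m\<bar>"
  have int: "(\<lambda>x. (?g m x)\<^sup>2) integrable_on {-pi..pi}" for m
    by (intro integrable_continuous_real continuous_intros)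
  have "(\<Sum>n\<in>square N. (green n)\<^sup>2) = (\<Sum>m\<in>?K. \<Sum>k\<in>?K. (green (k, m))\<^sup>2)"
    unfolding square_def by (subst sum.swap) (simp add: sum.cartesian_product)
  also have "\<dots> \<le> (\<Sum>m\<in>?K. 2 * pi * integral {-pi..pi} (\<lambda>x. (?g m x)\<^sup>2))"
    unfolding green_def fst_conv snd_conv
    by (intro sum_mono cosine_bessel continuous_intros)
  also have "\<dots> = 2 * pi * integral {-pi..pi} (\<lambda>x. \<Sum>m\<in>?K. (?g m x)\<^sup>2)"
    by (simp add: integral_sum int sum_distrib_left)
  also have "integral {-pi..pi} (\<lambda>x. \<Sum>m\<in>?K. (?g m x)\<^sup>2) \<le> integral {-pi..pi} (\<lambda>x. 2 :: real)"
  proof (intro integral_le integrable_sum int integrable_const_ivl)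
    fix x :: real
    have "(\<Sum>m\<in>?K. (?g m x)\<^sup>2) \<le> (\<Sum>m\<in>?K. (1 - decay x) * decay x ^ nat \<bar>m\<bar>)"
    proof (intro sum_mono)
      fix m
      have "decay x ^ nat \<bar>m\<bar> * decay x ^ nat \<bar>m\<bar> \<le> decay x ^ nat \<bar>m\<bar>"
        using decay_nonneg decay_le_1 by (simp add: mult_left_le power_le_one)
      then have "(profile x)\<^sup>2 * (decay x ^ nat \<bar>m\<bar> * decay x ^ nat \<bar>m\<bar>) \<le> (1 - decay x) * decay x ^ nat \<bar>m\<bar>"
        using profile_sq_le[of x] decay_nonneg[of x] decay_le_1[of x] by (intro mult_mono) auto
      then show "(?g m x)\<^sup>2 \<le> (1 - decay x) * decay x ^ nat \<bar>m\<bar>"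
        by (simp add: power2_eq_square mult_ac)
    qed
    also have "\<dots> \<le> 2" using decay_nonneg decay_le_1 by (rule sum_symmetric_geometric_le)
    finally show "(\<Sum>m\<in>?K. (?g m x)\<^sup>2) \<le> 2" .
  qed auto
  finally show ?thesis by (simp add: power2_eq_square)
qed

lemma green_ell2: "(\<lambda>n. complex_of_real (green n)) \<in> ell2"
proof -
  have "(\<Sum>n\<in>F. (green n)\<^sup>2) \<le> 8 * pi\<^sup>2" if F: "finite F" for F
  proof -
    obtain N where "F \<subseteq> square N" using finite_subset_square[OF F] .
    then have "(\<Sum>n\<in>F. (green n)\<^sup>2) \<le> (\<Sum>n\<in>square N. (green n)\<^sup>2)" by (intro sum_mono2) auto
    then show ?thesis using sum_green_sq_le[of N] by linarith
  qed
  then have "(\<lambda>n. (green n)\<^sup>2) summable_on UNIV"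
    by (intro nonneg_bdd_above_summable_on bdd_aboveI[where M = "8 * pi\<^sup>2"]) auto
  then show ?thesis by (simp add: ell2_def)
qed

section \<open>Nonvanishing of \<open>green\<close> at the three source sites\<close>

lemma profile_0: "profile 0 = 0"
  by (simp add: profile_def rootA_def)

lemma profile_nonneg: "0 \<le> profile x"
  using rootA_nonneg[of x] rootB_pos[of x] by (simp add: profile_def)

lemma green_0_pos: "0 < green (0, 0)"
proof -
  have g: "green (0, 0) = integral {-pi..pi} profile" by (simp add: green_def)
  have "profile pi \<noteq> 0" by (simp add: profile_def rootA_def rootB_def)
  moreover have "pi \<in> {-pi..pi}" by simp
  ultimately have "integral {-pi..pi} profile \<noteq> 0"
    using integral_eq_0_iff[of "-pi" pi profile] continuous_on_profile profile_nonneg by auto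
  moreover have "0 \<le> integral {-pi..pi} profile"
    by (intro integral_nonneg integrable_continuous_real continuous_on_profile profile_nonneg)
  ultimately show ?thesis by (simp add: g)
qed

lemma green_neg: "green (- k, m) = green (k, m)"
  by (simp add: green_def)

lemma green_1_neg: "green (1, 0) < 0"
proof -
  \<comment> \<open>1 / sqrt 3 is the value of \<open>profile\<close> where cos x = 0. The added
    cosine term integrates to zero, and \<open>profile\<close> exceeds this value exactly where cos
    x < 0, so \<open>h\<close> is nonnegative.\<close>
  define h where "h = (\<lambda>x. cos x / sqrt 3 - profile x * cos x)"
  have cont: "continuous_on {-pi..pi} h"
    unfolding h_def by (intro continuous_intros) auto
  have "0 \<le> h x" for x
  proof -
    have mono: "profile x \<le> 1 / sqrt 3 \<longleftrightarrow> 0 \<le> cos x"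
    proof -
      have "profile x = sqrt ((1 - cos x) / (3 - cos x))"
        by (simp add: profile_def rootA_def rootB_def real_sqrt_divide)
      moreover have "1 / sqrt 3 = sqrt (1 / 3)" by (simp add: real_sqrt_divide)
      ultimately have "profile x \<le> 1 / sqrt 3 \<longleftrightarrow> (1 - cos x) / (3 - cos x) \<le> 1 / 3" by simp
      also have "\<dots> \<longleftrightarrow> 0 \<le> cos x" using cos_less_3[of x] by (simp add: pos_divide_le_eq)
      finally show ?thesis .
    qed
    have "h x = cos x * (1 / sqrt 3 - profile x)" by (simp add: h_def algebra_simps)
    then show ?thesis using mono by (auto simp: zero_le_mult_iff)
  qed
  moreover have "h 0 \<noteq> 0" by (simp add: h_def profile_0)
  moreover have "0 \<in> {-pi..pi}" by simp
  ultimately have "integral {-pi..pi} h \<noteq> 0" "0 \<le> integral {-pi..pi} h"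
    using integral_eq_0_iff[OF cont] by (auto intro!: integral_nonneg integrable_continuous_real cont)
  moreover have "(h has_integral 0 / sqrt 3 - green (1, 0)) {-pi..pi}"
    unfolding h_def
    using has_integral_green[of 0 1] has_integral_cos_nx[of 1]
    by (intro has_integral_diff has_integral_divide) auto
  ultimately show ?thesis by (simp add: integral_unique)
qed

section \<open>Superposition of translates and choice of the potential\<close>

lemma ell2_add:
  assumes "u \<in> ell2" "v \<in> ell2"
  shows "(\<lambda>n. u n + v n) \<in> ell2"
proof -
  have "(\<lambda>n. 2 * (norm (u n))\<^sup>2 + 2 * (norm (v n))\<^sup>2) summable_on UNIV"
    using assms unfolding ell2_def by (intro summable_on_add summable_on_cmult_right) auto
  moreover have "(norm (u n + v n))\<^sup>2 \<le> 2 * (norm (u n))\<^sup>2 + 2 * (norm (v n))\<^sup>2" for n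
  proof -
    have "(norm (u n + v n))\<^sup>2 \<le> (norm (u n) + norm (v n))\<^sup>2" by (intro power_mono norm_triangle_ineq) auto
    also have "\<dots> \<le> 2 * (norm (u n))\<^sup>2 + 2 * (norm (v n))\<^sup>2"
      using sum_squares_bound[of "norm (u n)" "norm (v n)"] by (simp add: power2_sum)
    finally show ?thesis .
  qed
  ultimately show ?thesis unfolding ell2_def by (auto intro: summable_on_comparison_test)
qed

lemma ell2_cmult:
  assumes "u \<in> ell2"
  shows "(\<lambda>n. c * u n) \<in> ell2"
  using assms by (auto simp: ell2_def norm_mult power_mult_distrib intro: summable_on_cmult_right)

lemma ell2_translate:
  assumes "u \<in> ell2"
  shows "(\<lambda>n. u (n - a)) \<in> ell2"
proof -
  have "bij (\<lambda>n. n - a)" by (rule bij_betw_byWitness[where f' = "\<lambda>n. n + a"]) auto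
  then have "(\<lambda>n. (norm (u (n - a)))\<^sup>2) summable_on UNIV \<longleftrightarrow> (\<lambda>n. (norm (u n))\<^sup>2) summable_on UNIV"
    by (rule summable_on_reindex_bij_betw)
  then show ?thesis using assms by (simp add: ell2_def)
qed

lemma ell2_sum:
  assumes "finite A" "\<And>j. j \<in> A \<Longrightarrow> u j \<in> ell2"
  shows "(\<lambda>n. \<Sum>j\<in>A. u j n) \<in> ell2"
  using assms
proof (induction A rule: finite_induct)
  case empty
  then show ?case by (simp add: ell2_def)
qed (simp add: ell2_add)

lemma is_eigenvalue_4_potential:
  assumes "u \<in> ell2" "u \<noteq> (\<lambda>n. 0)" "\<And>n. 4 * u n - adjacency u n \<noteq> 0 \<Longrightarrow> u n \<noteq> 0"
  shows "\<exists>V. supp V = {n. 4 * u n - adjacency u n \<noteq> 0} \<and> is_eigenvalue (schroedinger V) 4"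
proof (intro exI conjI)
  \<comment> \<open>Where u vanishes so does its source, and division by zero gives V the value 0
    there.\<close>
  let ?V = "\<lambda>n. (4 * u n - adjacency u n) / u n"
  show "supp ?V = {n. 4 * u n - adjacency u n \<noteq> 0}" using assms(3) by (auto simp: supp_def)
  have "schroedinger ?V u n = 4 * u n" for n
    using assms(3)[of n] by (cases "u n = 0") (auto simp: schroedinger_def mult_op_def)
  then show "is_eigenvalue (schroedinger ?V) 4" using assms(1,2) by (auto simp: is_eigenvalue_def)
qed

text \<open>For such k the window of indices from k - L to k meets {-1, 0, 1}, so the polynomial in
  t has a nonzero coefficient.\<close>

lemma finite_roots_window:
  fixes c :: "int \<Rightarrow> real"
  assumes "c (-1) \<noteq> 0" "c 0 \<noteq> 0" "c 1 \<noteq> 0" and k: "k \<in> {-1..int L + 1}"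
  shows "finite {t. (\<Sum>j\<le>L. c (k - int j) * t ^ j) = 0}"
proof -
  consider "k = -1" | "k = int L + 1" | "0 \<le> k" "k \<le> int L" using k by force
  then have "\<exists>j\<le>L. c (k - int j) \<noteq> 0"
  proof cases
    case 1
    then show ?thesis using assms(1) by (intro exI[of _ 0]) auto
  next
    case 2
    then show ?thesis using assms(3) by (intro exI[of _ L]) auto
  next
    case 3
    then show ?thesis using assms(2) by (intro exI[of _ "nat k"]) auto
  qed
  then show ?thesis using polyfun_rootbound_finite[where c = "\<lambda>j. c (k - int j)"] by blast
qed

lemma ex_potential_4:
  assumes "K \<ge> 3"
  shows "\<exists>V. finite (supp V) \<and> card (supp V) = K \<and> is_eigenvalue (schroedinger V) 4"
proof -
  \<comment> \<open>L + 1 consecutive translates of a three-site source cover L + 3 sites.\<close>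
  define L where "L = K - 3"
  let ?I = "{-1..int L + 1}"
  let ?P = "\<lambda>c k t. \<Sum>j\<le>L. c (k - int j) * t ^ j"
  have s: "source (-1) \<noteq> 0" "source 0 \<noteq> 0" "source 1 \<noteq> 0" by (simp_all add: source_def)
  have g: "green (-1, 0) \<noteq> 0" "green (0, 0) \<noteq> 0" "green (1, 0) \<noteq> 0"
    using green_0_pos green_1_neg green_neg[of 1 0] by auto
  \<comment> \<open>The parameters t at which the source or u vanishes somewhere on the K
    sites.\<close>
  define B where "B = (\<Union>k\<in>?I. {t. ?P source k t = 0} \<union> {t. ?P (\<lambda>k. green (k, 0)) k t = 0})"
  have "finite B"
    unfolding B_def by (intro finite_UN_I finite_UnI finite_roots_window s g finite_atLeastAtMost_int)
  then obtain t where "t \<notin> B"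
    using ex_new_if_finite[OF infinite_UNIV_char_0[where 'a = real]] by blast
  then have t: "k \<in> ?I \<Longrightarrow> ?P source k t \<noteq> 0"
    "k \<in> ?I \<Longrightarrow> ?P (\<lambda>k. green (k, 0)) k t \<noteq> 0" for k
    unfolding B_def by blast+
  define U where "U = (\<lambda>n. \<Sum>j\<le>L. green (n - (int j, 0)) * t ^ j)"
  define u where "u = (\<lambda>n. complex_of_real (U n))"
  have "u = (\<lambda>n. \<Sum>j\<le>L. of_real (t ^ j) * complex_of_real (green (n - (int j, 0))))"
    by (simp add: u_def U_def mult.commute)
  also have "\<dots> \<in> ell2"
    by (intro ell2_sum ell2_cmult ell2_translate[of "\<lambda>n. complex_of_real (green n)"] green_ell2) auto
  finally have u2: "u \<in> ell2" .
  have U: "4 * U (k, m) - (U (k + 1, m) + U (k - 1, m) + U (k, m + 1) + U (k, m - 1))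
      = (if m = 0 then ?P source k t else 0)" for k m
  proof -
    have "4 * U (k, m) - (U (k + 1, m) + U (k - 1, m) + U (k, m + 1) + U (k, m - 1))
      = (\<Sum>j\<le>L. (4 * green (k - int j, m) - (green (k - int j + 1, m) + green (k - int j - 1, m)
            + green (k - int j, m + 1) + green (k - int j, m - 1))) * t ^ j)"
      by (simp add: U_def algebra_simps sum.distrib sum_subtractf sum_distrib_left)
    also have "\<dots> = (if m = 0 then ?P source k t else 0)" unfolding green_source by simp
    finally show ?thesis .
  qed
  have f: "4 * u (k, m) - adjacency u (k, m) = of_real (if m = 0 then ?P source k t else 0)" for k m
  proof -
    have "4 * u (k, m) - adjacency u (k, m)
        = of_real (4 * U (k, m) - (U (k + 1, m) + U (k - 1, m) + U (k, m + 1) + U (k, m - 1)))"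
      by (simp add: u_def adjacency_pair)
    then show ?thesis unfolding U .
  qed
  have zero: "?P source k t = 0" if "k \<notin> ?I" for k
    using that by (intro sum.neutral) (auto simp: source_def)
  have supp_f: "{n. 4 * u n - adjacency u n \<noteq> 0} = ?I \<times> {0}"
  proof (rule set_eqI)
    fix n :: site
    obtain k m where n: "n = (k, m)" by (cases n)
    show "n \<in> {n. 4 * u n - adjacency u n \<noteq> 0} \<longleftrightarrow> n \<in> ?I \<times> {0}"
      using t(1)[of k] zero[of k] unfolding n mem_Collect_eq f of_real_eq_0_iff by auto
  qed
  have u_nz: "u n \<noteq> 0" if "n \<in> ?I \<times> {0}" for n
  proof -
    obtain k where k: "n = (k, 0)" "k \<in> ?I" using \<open>n \<in> _\<close> by auto
    show ?thesis using t(2)[OF k(2)] unfolding u_def U_def k(1) of_real_eq_0_iff by simp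
  qed
  then have "u (0, 0) \<noteq> 0" by simp
  then have "u \<noteq> (\<lambda>n. 0)" by (rule contrapos_nn) simp
  moreover have "u n \<noteq> 0" if "4 * u n - adjacency u n \<noteq> 0" for n
    using that supp_f by (intro u_nz) blast
  ultimately obtain V where "supp V = ?I \<times> {0}" "is_eigenvalue (schroedinger V) 4"
    using is_eigenvalue_4_potential[OF u2] unfolding supp_f by blast
  moreover have "card (?I \<times> {0::int}) = K" using assms by (simp add: L_def card_cartesian_product)
  ultimately show ?thesis by (intro exI[of _ V]) auto
qed

text \<open>In the second part finiteness is stated explicitly because \<open>card\<close> of an
  infinite set is 0.\<close>

theorem theorem4:
  shows "(\<forall>K::nat. \<forall>\<mu>::complex. K \<ge> 3 \<longrightarrow> \<mu> \<in> {-4, 4} \<longrightarrow>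
            (\<exists>V. finite (supp V) \<and> card (supp V) = K \<and> is_eigenvalue (schroedinger V) \<mu>))
       \<and> (\<forall>V. finite (supp V) \<longrightarrow> card (supp V) \<le> 2 \<longrightarrow>
            \<not> is_eigenvalue (schroedinger V) 4 \<and> \<not> is_eigenvalue (schroedinger V) (-4))"
proof (intro conjI allI impI)
  fix K :: nat and \<mu> :: complex
  assume K: "K \<ge> 3" and \<mu>: "\<mu> \<in> {-4, 4}"
  obtain V where V: "finite (supp V)" "card (supp V) = K" "is_eigenvalue (schroedinger V) 4"
    using ex_potential_4[OF K] by blast
  show "\<exists>V. finite (supp V) \<and> card (supp V) = K \<and> is_eigenvalue (schroedinger V) \<mu>"
  proof (cases "\<mu> = 4")
    case True
    then show ?thesis using V by blast
  next
    case False
    then have "\<mu> = -4" using \<mu> by simp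
    then show ?thesis using V eigenvalue_sign_flip[OF V(3)] supp_uminus[of V]
      by (intro exI[of _ "\<lambda>n. - V n"]) simp
  qed
next
  fix V assume V: "finite (supp V)" "card (supp V) \<le> 2"
  then show "\<not> is_eigenvalue (schroedinger V) 4" by (rule not_eigenvalue_4)
  show "\<not> is_eigenvalue (schroedinger V) (-4)"
    using eigenvalue_sign_flip[of V "-4"] not_eigenvalue_4[of "\<lambda>n. - V n"] V
    by (auto simp: supp_uminus)
qed

end
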